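(* Let $\mathsf{T}$ be a centrally symmetric triangulation of the sphere $\mathcal{S}^{n-1}$ and let $\lambda_1,\ldots,\lambda_n$ be $n$ compatible Fan labelings of $\mathsf{T}$. Suppose the simplicial complex $\mathsf{T}/\mathbb{Z}_2$ is balanced. Then there are at least $n!$ pairs $(\sigma,\pi)$, where $\sigma$ is a simplex of $\mathsf{T}$ and $\pi\colon V(\sigma)\to[n]$ is a bijection, such that for some ordering $v_1,\ldots,v_n$ of the vertices of $\sigma$, $$0<-\lambda_{\pi(v_1)}(v_1)<\lambda_{\pi(v_2)}(v_2)<\cdots<(-1)^n\lambda_{\pi(v_n)}(v_n).$$
   Context: $\mathsf{T}$ is a free simplicial $\mathbb{Z}_2$-complex via the antipodal map. A Fan labeling of $\mathsf{T}$ is a labeling of its vertices by non-zero integers such that (i) no two adjacent vertices have labels summing to zero, and (ii) antipodal vertices have labels summing to zero. Fan labelings $\lambda_1,\ldots,\lambda_n$ are compatible if $\lambda_i(u)+\lambda_{i'}(u')\neq0$ for any two adjacent (distinct) vertices $u,u'$ and any $i,i'$. $\mathsf{T}/\mathbb{Z}_2$ is the triangulation of the $(n-1)$-dimensional projective space obtained by identifying antipodal simplices. A $d$-dimensional simplicial complex is balanced if its vertices can be colored with $d+1$ colors so that every $d$-dimensional simplex has vertices of pairwise distinct colors. *)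

theory Defs
  imports "HOL-Analysis.Analysis" "HOL-Library.FuncSet"
begin

definition geom_simplicial_complex :: "('a::euclidean_space) set set \<Rightarrow> bool" where
  "geom_simplicial_complex K \<longleftrightarrow>
     finite K \<and>
     (\<forall>\<sigma>\<in>K. finite \<sigma> \<and> \<sigma> \<noteq> {} \<and> \<not> affine_dependent \<sigma>) \<and>
     (\<forall>\<sigma>\<in>K. \<forall>\<tau>. \<tau> \<subseteq> \<sigma> \<and> \<tau> \<noteq> {} \<longrightarrow> \<tau> \<in> K) \<and>
     (\<forall>\<sigma>\<in>K. \<forall>\<tau>\<in>K. convex hull \<sigma> \<inter> convex hull \<tau> = convex hull (\<sigma> \<inter> \<tau>))"

definition polyhedron :: "('a::euclidean_space) set set \<Rightarrow> 'a set" where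
  "polyhedron K = (\<Union>\<sigma>\<in>K. convex hull \<sigma>)"

definition vertices :: "'a set set \<Rightarrow> 'a set" where
  "vertices K = \<Union>K"

definition adjacent :: "'a set set \<Rightarrow> 'a \<Rightarrow> 'a \<Rightarrow> bool" where
  "adjacent K u u' \<longleftrightarrow> u \<noteq> u' \<and> {u, u'} \<in> K"

text \<open>A centrally symmetric triangulation of the sphere S^(n-1) (the unit sphere of
real^'n, n = CARD('n)): a geometric complex K, closed under the antipodal map
(negation), together with an equivariant homeomorphism of its polyhedron onto the sphere.
The antipodal map of T is thus x \<mapsto> -x, acting on vertices by v \<mapsto> -v.\<close>

definition cs_sphere_triangulation ::
  "('a::euclidean_space) set set \<Rightarrow> (real^'n) set \<Rightarrow> bool" where
  "cs_sphere_triangulation K S \<longleftrightarrow>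
     geom_simplicial_complex K \<and>
     (\<forall>\<sigma>\<in>K. uminus ` \<sigma> \<in> K) \<and>
     (\<exists>h g. homeomorphism (polyhedron K) S h g \<and>
            (\<forall>x\<in>polyhedron K. h (- x) = - h x))"

definition fan_labeling :: "('a::euclidean_space) set set \<Rightarrow> ('a \<Rightarrow> int) \<Rightarrow> bool" where
  "fan_labeling K lab \<longleftrightarrow>
     (\<forall>v\<in>vertices K. lab v \<noteq> 0 \<and> lab (- v) + lab v = 0) \<and>
     (\<forall>u u'. adjacent K u u' \<longrightarrow> lab u + lab u' \<noteq> 0)"

definition compatible_labelings ::
  "('a::euclidean_space) set set \<Rightarrow> nat set \<Rightarrow> (nat \<Rightarrow> 'a \<Rightarrow> int) \<Rightarrow> bool" where
  "compatible_labelings K I lab \<longleftrightarrow>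
     (\<forall>u u' i i'. adjacent K u u' \<and> i \<in> I \<and> i' \<in> I \<longrightarrow> lab i u + lab i' u' \<noteq> 0)"

text \<open>T/Z2 balanced (dimension n-1, so n colours): a colouring of the vertices of T/Z2,
i.e. of antipodal vertex pairs, by n colours such that every (n-1)-simplex of T/Z2
(the image of an n-vertex simplex of T) has pairwise distinct colours.\<close>

definition quotient_balanced :: "('a::euclidean_space) set set \<Rightarrow> nat \<Rightarrow> bool" where
  "quotient_balanced K n \<longleftrightarrow>
     (\<exists>c :: 'a \<Rightarrow> nat. (\<forall>v\<in>vertices K. c v < n \<and> c (- v) = c v) \<and>
        (\<forall>\<sigma>\<in>K. card \<sigma> = n \<longrightarrow> inj_on c \<sigma>))"

definition alt_chain :: "(nat \<Rightarrow> 'a \<Rightarrow> int) \<Rightarrow> ('a \<Rightarrow> nat) \<Rightarrow> 'a list \<Rightarrow> bool" where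
  "alt_chain lab \<pi> vs \<longleftrightarrow>
     (let a = (\<lambda>k. (-1) ^ (k + 1) * lab (\<pi> (vs ! k)) (vs ! k)) in
       0 < a 0 \<and> (\<forall>k. k + 1 < length vs \<longrightarrow> a k < a (k + 1)))"

definition good_pairs ::
  "('a::euclidean_space) set set \<Rightarrow> nat \<Rightarrow> (nat \<Rightarrow> 'a \<Rightarrow> int) \<Rightarrow> ('a set \<times> ('a \<Rightarrow> nat)) set" where
  "good_pairs K n lab =
     {(\<sigma>, \<pi>). \<sigma> \<in> K \<and> \<pi> \<in> \<sigma> \<rightarrow>\<^sub>E {1..n} \<and> bij_betw \<pi> \<sigma> {1..n} \<and>
        (\<exists>vs. distinct vs \<and> set vs = \<sigma> \<and> alt_chain lab \<pi> vs)}"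

end

theory Submission
  imports Defs "HOL-Homology.Homology"
begin

text \<open>
  Let \<open>c\<close> colour the antipodal pairs of vertices. For every permutation \<open>p\<close> of \<open>{1..n}\<close>, the labeling
  that gives \<open>v\<close> the label \<open>\<lambda>\<^bsub>p (c v)\<^esub> v\<close> is again a Fan labeling, by compatibility; Fan's lemma yields
  an alternating simplex \<open>\<sigma>\<close>, hence the pair \<open>(\<sigma>, p \<circ> c)\<close>. Since \<open>c\<close> is bijective on \<open>\<sigma>\<close>, the pair
  determines \<open>p\<close>, so there are at least \<open>n!\<close> pairs.

  Fan's lemma holds for singular chains. As the sphere is acyclic below its dimension, there are
  chains \<open>e k\<close> (hemispheres) with \<open>\<partial> (e (k + 1)) = e k \<plusminus> \<nu> (e k)\<close>, \<open>\<nu>\<close> the antipode, and after subdivision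
  all their simplices are small. Label a point of the sphere by the label of a vertex of the
  triangulation whose barycentric coordinate at that point is at least a constant \<open>\<epsilon>\<close>, chosen
  equivariantly. The vertices so assigned to the corners of a small singular simplex lie in a common
  simplex of the triangulation, so an alternating singular simplex is what has to be found. Modulo 2,
  the number of alternating simplices of \<open>e k\<close> of either sign does not depend on \<open>k\<close>, and it is 1
  for \<open>k = 0\<close>.
\<close>

section \<open>Alternating sets of integers\<close>

text \<open>Sorted by absolute value, which has no ties, the elements alternate in sign, and the
  smallest has the sign of \<open>s\<close>. Sets suffice, since the order of the corners of a
  simplex does not matter.\<close>

inductive alternating :: "int \<Rightarrow> int set \<Rightarrow> bool" where
  empty: "alternating s {}"
| insert: "\<lbrakk>0 < s * x; \<And>y. y \<in> T \<Longrightarrow> \<bar>x\<bar> < \<bar>y\<bar>; alternating (-s) T\<rbrakk> \<Longrightarrow> alternating s (insert x T)"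

lemma alternating_uminus: "alternating s T \<Longrightarrow> alternating (-s) (uminus ` T)"
proof (induction rule: alternating.induct)
  case (insert s x T)
  then show ?case
    by (auto intro!: alternating.insert simp: image_iff)
qed (auto intro: alternating.empty)

lemma alternating_uminus_iff: "alternating s (uminus ` T) \<longleftrightarrow> alternating (-s) T"
  using alternating_uminus[of s "uminus ` T"] alternating_uminus[of "-s" T]
  by (auto simp: image_image)

text \<open>The element of least absolute value is determined by the set, so the last rule applied
  can only have split off \<open>x\<close>.\<close>

lemma alternating_insert_iff:
  assumes "\<And>y. y \<in> T \<Longrightarrow> \<bar>x\<bar> < \<bar>y\<bar>"
  shows "alternating s (insert x T) \<longleftrightarrow> 0 < s * x \<and> alternating (-s) T"
proof
  assume "alternating s (insert x T)"
  then show "0 < s * x \<and> alternating (-s) T"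
  proof (cases rule: alternating.cases)
    case (insert x' T')
    have "x \<in> insert x' T'" "x' \<in> insert x T"
      using insert(1) by auto
    then have "x' = x"
      using assms insert(3) by fastforce
    moreover from this have "T' = T"
      using assms insert(1,3) by (metis insert_ident less_irrefl)
    ultimately show ?thesis
      using insert by simp
  qed simp
qed (use assms in \<open>auto intro: alternating.insert\<close>)

lemma alternating_list:
  assumes "alternating s T"
  obtains xs where "set xs = T" "distinct xs"
    "\<And>k. k < length xs \<Longrightarrow> 0 < s * (-1) ^ k * xs ! k"
    "\<And>k. Suc k < length xs \<Longrightarrow> \<bar>xs ! k\<bar> < \<bar>xs ! Suc k\<bar>"
proof -
  from assms have "\<exists>xs. set xs = T \<and> distinct xs \<and>
      (\<forall>k < length xs. 0 < s * (-1) ^ k * xs ! k) \<and>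
      (\<forall>k. Suc k < length xs \<longrightarrow> \<bar>xs ! k\<bar> < \<bar>xs ! Suc k\<bar>)"
  proof (induction rule: alternating.induct)
    case (insert s x T)
    then obtain xs where xs: "set xs = T" "distinct xs"
      "\<And>k. k < length xs \<Longrightarrow> 0 < - s * (-1) ^ k * xs ! k"
      "\<And>k. Suc k < length xs \<Longrightarrow> \<bar>xs ! k\<bar> < \<bar>xs ! Suc k\<bar>"
      by auto
    have "0 < s * (-1) ^ k * (x # xs) ! k" if "k < length (x # xs)" for k
      using that xs(3) insert(1) by (cases k) auto
    moreover have "\<bar>(x # xs) ! k\<bar> < \<bar>(x # xs) ! Suc k\<bar>" if "Suc k < length (x # xs)" for k
      using that xs insert(2) by (cases k) auto
    ultimately show ?case
      using xs(1,2) insert(2) by (intro exI[of _ "x # xs"] conjI allI impI) auto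
  qed auto
  with that show thesis by blast
qed

text \<open>Deleting the smallest element from a set alternating with leading sign \<open>- s\<close>, or the largest
  from one with leading sign \<open>s\<close>, leaves a set alternating with leading sign \<open>s\<close>; in a
  non-alternating set, the suitable deletions come in pairs.\<close>
lemma alternating_remove_parity:
  assumes "finite T" "s = 1 \<or> s = -1" "\<And>x y. x \<in> T \<Longrightarrow> y \<in> T \<Longrightarrow> x + y \<noteq> 0"
  shows "even ((\<Sum>y\<in>T. of_bool (alternating s (T - {y})))
               + of_bool (alternating s T) + of_bool (alternating (-s) T) :: int)"
  using assms
proof (induction "card T" arbitrary: s T)
  case 0
  then show ?case by (simp add: alternating.empty)
next
  case (Suc n)
  then have ne: "T \<noteq> {}" by auto
  define x where "x = arg_min_on abs T"
  have x: "x \<in> T" "\<And>y. y \<in> T \<Longrightarrow> \<bar>x\<bar> \<le> \<bar>y\<bar>"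
    using ne Suc.prems(1) by (auto simp: x_def arg_min_if_finite arg_min_least)
  define U where "U = T - {x}"
  have U: "T = insert x U" "x \<notin> U" "finite U" "n = card U"
    using x Suc by (auto simp: U_def)
  \<comment> \<open>A tie between different elements would force \<open>x + y = 0\<close>.\<close>
  have less: "\<bar>x\<bar> < \<bar>y\<bar>" if "y \<in> U" for y
    using x(2)[of y] Suc.prems(3)[of x y] x(1) that by (auto simp: U_def abs_if split: if_splits)
  have x0: "x \<noteq> 0" using Suc.prems(3)[of x x] x(1) by auto
  have IH: "even ((\<Sum>y\<in>U. of_bool (alternating (-s) (U - {y})))
               + of_bool (alternating (-s) U) + of_bool (alternating s U) :: int)"
    using Suc.hyps(1)[of U "-s"] Suc.prems U by auto
  have rem: "alternating s (T - {y}) \<longleftrightarrow> 0 < s * x \<and> alternating (-s) (U - {y})" if "y \<in> U" for y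
  proof -
    have "T - {y} = insert x (U - {y})" using that U by auto
    then show ?thesis using less alternating_insert_iff[of "U - {y}" x s] by auto
  qed
  have "(\<Sum>y\<in>T. of_bool (alternating s (T - {y})) :: int)
      = of_bool (alternating s U) + (\<Sum>y\<in>U. of_bool (alternating s (T - {y})))"
    using U by (simp add: U_def[symmetric])
  also have "(\<Sum>y\<in>U. of_bool (alternating s (T - {y})) :: int)
      = of_bool (0 < s * x) * (\<Sum>y\<in>U. of_bool (alternating (-s) (U - {y})))"
    unfolding sum_distrib_left by (intro sum.cong) (auto simp: rem)
  finally have sum: "(\<Sum>y\<in>T. of_bool (alternating s (T - {y})) :: int) = of_bool (alternating s U) +
      of_bool (0 < s * x) * (\<Sum>y\<in>U. of_bool (alternating (-s) (U - {y})))" .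
  have sgn: "0 < - s * x \<longleftrightarrow> \<not> 0 < s * x"
    using Suc.prems(2) x0 by auto
  have "alternating s T \<longleftrightarrow> 0 < s * x \<and> alternating (-s) U"
    "alternating (-s) T \<longleftrightarrow> \<not> 0 < s * x \<and> alternating s U"
    using alternating_insert_iff[of U x s] alternating_insert_iff[of U x "-s"] less U(1) sgn by auto
  \<comment> \<open>If \<open>0 < s * x\<close>, the total is the one in \<open>IH\<close>;
    otherwise only two equal copies of the indicator of \<open>alternating s U\<close>
    remain.\<close>
  then show ?case
    using IH by (cases "0 < s * x") (auto simp: sum)
qed

text \<open>Families, unlike sets, may repeat labels. If \<open>t i = t j\<close> with
  \<open>i \<noteq> j\<close>, only deleting \<open>i\<close> or \<open>j\<close> can restore
  injectivity, and both deletions leave the same labels.\<close>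

lemma alternating_family_parity:
  fixes t :: "'i \<Rightarrow> int"
  assumes "finite I" "s = 1 \<or> s = -1" "\<And>i j. i \<in> I \<Longrightarrow> j \<in> I \<Longrightarrow> t i + t j \<noteq> 0"
  defines "P \<equiv> \<lambda>s J. inj_on t J \<and> alternating s (t ` J)"
  shows "even ((\<Sum>i\<in>I. of_bool (P s (I - {i}))) + of_bool (P s I) + of_bool (P (-s) I) :: int)"
proof (cases "inj_on t I")
  case True
  have "t ` (I - {i}) = t ` I - {t i}" if "i \<in> I" for i
    using True that by (auto simp: inj_on_def)
  then have "(\<Sum>i\<in>I. of_bool (P s (I - {i})) :: int) = (\<Sum>i\<in>I. of_bool (alternating s (t ` I - {t i})))"
    using True by (intro sum.cong) (auto simp: P_def inj_on_diff)
  also have "\<dots> = (\<Sum>y\<in>t ` I. of_bool (alternating s (t ` I - {y})))"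
    using True by (simp add: sum.reindex)
  finally have sum: "(\<Sum>i\<in>I. of_bool (P s (I - {i})) :: int)
      = (\<Sum>y\<in>t ` I. of_bool (alternating s (t ` I - {y})))" .
  have "even ((\<Sum>y\<in>t ` I. of_bool (alternating s (t ` I - {y})))
      + of_bool (alternating s (t ` I)) + of_bool (alternating (-s) (t ` I)) :: int)"
    using assms(1-3) by (intro alternating_remove_parity) auto
  then show ?thesis
    unfolding sum using True by (simp add: P_def)
next
  case False
  then obtain i j where ij: "i \<in> I" "j \<in> I" "i \<noteq> j" "t i = t j"
    by (auto simp: inj_on_def)
  have "(\<Sum>k\<in>I. of_bool (P s (I - {k})) :: int) = (\<Sum>k\<in>{i,j}. of_bool (P s (I - {k})))"
  proof (rule sum.mono_neutral_right)
    show "\<forall>k\<in>I - {i, j}. of_bool (P s (I - {k})) = (0::int)"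
      using ij by (auto simp: P_def inj_on_def)
  qed (use assms ij in auto)
  moreover have "P s (I - {i}) = P s (I - {j})"
  proof -
    have im: "t ` (I - {i}) = t ` (I - {j})"
      using ij by (auto simp: image_iff) (metis insertE insert_Diff)+
    \<comment> \<open>On a finite set injectivity means that domain and image have equal
      cardinality, so it transfers from one deletion to the other.\<close>
    have "card (I - {i}) = card (I - {j})"
      using ij assms by simp
    then have "inj_on t (I - {i}) = inj_on t (I - {j})"
      using im assms(1) by (metis card_image eq_card_imp_inj_on finite_Diff)
    then show ?thesis by (simp add: P_def im)
  qed
  ultimately have "(\<Sum>k\<in>I. of_bool (P s (I - {k})) :: int) = 2 * of_bool (P s (I - {i}))"
    using ij(3) by simp
  then show ?thesis
    using False by (simp add: P_def)
qed


section \<open>Counting alternating simplices of singular chains\<close>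

text \<open>The integer-linear extension of \<open>w\<close> to chains. As
  \<open>frag_extend\<close> takes values in free abelian groups, the integers appear as the one on
  \<open>()\<close>, whose coefficient is read off.\<close>

definition chain_weight :: "(((nat \<Rightarrow> real) \<Rightarrow> 'a) \<Rightarrow> int) \<Rightarrow> 'a chain \<Rightarrow> int" where
  "chain_weight w c = poly_mapping.lookup (frag_extend (\<lambda>f. frag_cmul (w f) (frag_of ())) c) ()"

lemma chain_weight_of [simp]: "chain_weight w (frag_of f) = w f"
  by (simp add: chain_weight_def)

lemma chain_weight_0 [simp]: "chain_weight w 0 = 0"
  by (simp add: chain_weight_def)

lemma chain_weight_add: "chain_weight w (a + b) = chain_weight w a + chain_weight w b"
  by (simp add: chain_weight_def frag_extend_add lookup_add)

lemma chain_weight_diff: "chain_weight w (a - b) = chain_weight w a - chain_weight w b"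
  by (simp add: chain_weight_def frag_extend_diff lookup_minus)

lemma chain_weight_cmul: "chain_weight w (frag_cmul k c) = k * chain_weight w c"
  by (simp add: chain_weight_def frag_extend_cmul)

lemma chain_weight_sum: "chain_weight w (sum g I) = (\<Sum>i\<in>I. chain_weight w (g i))"
  by (induction I rule: infinite_finite_induct) (auto simp: chain_weight_add)

lemma chain_weight_nonzeroD:
  assumes "chain_weight w c \<noteq> 0"
  obtains f where "f \<in> Poly_Mapping.keys c" "w f \<noteq> 0"
  using assms frag_extend_eq_0[of c "\<lambda>f. frag_cmul (w f) (frag_of ())"]
  by (force simp: chain_weight_def)

definition simplex_vertex :: "((nat \<Rightarrow> real) \<Rightarrow> 'a) \<Rightarrow> nat \<Rightarrow> 'a" where
  "simplex_vertex f i = f (\<lambda>j. if j = i then 1 else 0)"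

text \<open>Injectivity forces \<open>p + 1\<close> different labels; the alternating set alone
  would hide repetitions.\<close>

definition alternating_simplex :: "('a \<Rightarrow> int) \<Rightarrow> int \<Rightarrow> nat \<Rightarrow> ((nat \<Rightarrow> real) \<Rightarrow> 'a) \<Rightarrow> bool" where
  "alternating_simplex l s p f \<longleftrightarrow>
     inj_on (\<lambda>i. l (simplex_vertex f i)) {..p} \<and> alternating s ((\<lambda>i. l (simplex_vertex f i)) ` {..p})"

abbreviation fan_count :: "('a \<Rightarrow> int) \<Rightarrow> int \<Rightarrow> nat \<Rightarrow> 'a chain \<Rightarrow> int" where
  "fan_count l s p \<equiv> chain_weight (\<lambda>f. of_bool (alternating_simplex l s p f))"

lemma simplex_vertex_singular_face:
  assumes "j \<le> p"
  shows "simplex_vertex (singular_face (Suc p) k f) j = simplex_vertex f (if j < k then j else Suc j)"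
proof -
  have "simplical_face k (\<lambda>i. if i = j then 1 else 0)
      = (\<lambda>i. if i = (if j < k then j else Suc j) then 1 else (0::real))"
    by (auto simp: simplical_face_def fun_eq_iff)
  then show ?thesis
    using assms by (simp add: simplex_vertex_def singular_face_def)
qed

lemma alternating_simplex_singular_face:
  assumes "k \<le> Suc p"
  shows "alternating_simplex l s p (singular_face (Suc p) k f) \<longleftrightarrow>
    inj_on (\<lambda>i. l (simplex_vertex f i)) ({..Suc p} - {k}) \<and>
    alternating s ((\<lambda>i. l (simplex_vertex f i)) ` ({..Suc p} - {k}))"
proof -
  \<comment> \<open>\<open>\<delta>\<close> enumerates \<open>{..Suc p}\<close> without
    \<open>k\<close>, the corners of the \<open>k\<close>-th face.\<close>
  define \<delta> where "\<delta> j = (if j < k then j else Suc j)" for j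
  let ?t = "\<lambda>i. l (simplex_vertex f i)"
  let ?u = "\<lambda>i. l (simplex_vertex (singular_face (Suc p) k f) i)"
  have inj: "inj_on \<delta> {..p}"
    by (auto simp: inj_on_def \<delta>_def split: if_splits)
  have im: "\<delta> ` {..p} = {..Suc p} - {k}"
  proof -
    have "i \<in> \<delta> ` {..p}" if "i \<le> Suc p" "i \<noteq> k" for i
      using that assms by (intro image_eqI[of _ _ "if i < k then i else i - 1"]) (auto simp: \<delta>_def)
    then show ?thesis
      by (auto simp: \<delta>_def)
  qed
  have u: "?u i = (?t \<circ> \<delta>) i" if "i \<in> {..p}" for i
    using that by (simp add: simplex_vertex_singular_face \<delta>_def)
  have "inj_on ?u {..p} \<longleftrightarrow> inj_on (?t \<circ> \<delta>) {..p}"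
    using u by (intro inj_on_cong) auto
  also have "\<dots> \<longleftrightarrow> inj_on ?t ({..Suc p} - {k})"
    using comp_inj_on_iff[OF inj, of ?t] by (simp add: im)
  finally have 1: "inj_on ?u {..p} \<longleftrightarrow> inj_on ?t ({..Suc p} - {k})" .
  have "?u ` {..p} = (?t \<circ> \<delta>) ` {..p}"
    using u by (intro image_cong) auto
  also have "\<dots> = ?t ` ({..Suc p} - {k})"
    by (simp only: image_comp[symmetric] im)
  finally show ?thesis
    unfolding alternating_simplex_def by (simp only: 1)
qed

text \<open>By linearity one simplex suffices. Its faces enter the boundary with signs, invisible
  modulo 2, and correspond to deletions from the family of corner labels.\<close>

lemma fan_count_boundary_parity:
  assumes "s = 1 \<or> s = -1"
    and "\<And>f i j. \<lbrakk>f \<in> Poly_Mapping.keys c; i \<le> Suc p; j \<le> Suc p\<rbrakk>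
          \<Longrightarrow> l (simplex_vertex f i) + l (simplex_vertex f j) \<noteq> 0"
  shows "even (fan_count l s p (chain_boundary (Suc p) c)
             + fan_count l s (Suc p) c + fan_count l (-s) (Suc p) c)"
proof -
  define S where "S = {f. \<forall>i\<le>Suc p. \<forall>j\<le>Suc p. l (simplex_vertex f i) + l (simplex_vertex f j) \<noteq> 0}"
  have "Poly_Mapping.keys c \<subseteq> S"
    using assms(2) by (auto simp: S_def)
  then show ?thesis
  proof (induction c rule: frag_induction)
    case (one f)
    let ?a = "\<lambda>k. of_bool (alternating_simplex l s p (singular_face (Suc p) k f)) :: int"
    have "fan_count l s p (chain_boundary (Suc p) (frag_of f)) = (\<Sum>k\<le>Suc p. (-1) ^ k * ?a k)"
      by (simp only: chain_boundary_of chain_weight_sum chain_weight_cmul chain_weight_of if_False nat.simps)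
    moreover have "even ((\<Sum>k\<le>Suc p. (-1) ^ k * ?a k) + (\<Sum>k\<le>Suc p. ?a k))"
      unfolding sum.distrib[symmetric] by (rule dvd_sum) auto
    moreover have "even ((\<Sum>k\<le>Suc p. ?a k)
        + of_bool (alternating_simplex l s (Suc p) f) + of_bool (alternating_simplex l (-s) (Suc p) f))"
    proof -
      have "(\<Sum>k\<le>Suc p. ?a k) = (\<Sum>k\<in>{..Suc p}.
          of_bool (inj_on (\<lambda>i. l (simplex_vertex f i)) ({..Suc p} - {k}) \<and>
            alternating s ((\<lambda>i. l (simplex_vertex f i)) ` ({..Suc p} - {k}))))"
        by (intro sum.cong refl) (simp only: alternating_simplex_singular_face atMost_iff)
      then show ?thesis
        using alternating_family_parity[of "{..Suc p}" s "\<lambda>i. l (simplex_vertex f i)"] assms(1) one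
        by (simp only: alternating_simplex_def) (simp add: S_def)
    qed
    ultimately show ?case
      by (simp only: chain_weight_of) presburger
  next
    case (diff a b)
    then show ?case
      by (simp only: chain_boundary_diff chain_weight_diff) presburger
  qed simp
qed

text \<open>Negating all labels keeps the pattern and reverses its leading sign.\<close>

lemma fan_count_antipode:
  assumes "singular_chain p X c"
    and "\<And>x. x \<in> topspace X \<Longrightarrow> l (\<nu> x) = - l x"
  shows "fan_count l s p (chain_map p \<nu> c) = fan_count l (-s) p c"
proof -
  have "Poly_Mapping.keys c \<subseteq> singular_simplex_set p X"
    using assms(1) by (simp add: singular_chain_def)
  then show ?thesis
  proof (induction c rule: frag_induction)
    case (one f)
    then have f: "f \<in> standard_simplex p \<rightarrow> topspace X"
      by (auto simp: singular_simplex_def continuous_map_def Pi_iff)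
    have *: "l (simplex_vertex (simplex_map p \<nu> f) i) = - l (simplex_vertex f i)" if "i \<in> {..p}" for i
      using that assms(2) f by (auto simp: simplex_vertex_def simplex_map_def Pi_iff)
    have "(\<lambda>i. l (simplex_vertex (simplex_map p \<nu> f) i)) ` {..p}
        = uminus ` (\<lambda>i. l (simplex_vertex f i)) ` {..p}"
      unfolding image_image using * by (intro image_cong) auto
    moreover have "inj_on (\<lambda>i. l (simplex_vertex (simplex_map p \<nu> f) i)) {..p}
        \<longleftrightarrow> inj_on (\<lambda>i. l (simplex_vertex f i)) {..p}"
      using * by (auto simp: inj_on_def)
    ultimately have "alternating_simplex l s p (simplex_map p \<nu> f) = alternating_simplex l (-s) p f"
      by (simp only: alternating_simplex_def alternating_uminus_iff)
    then show ?case by simp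
  next
    case (diff a b)
    then show ?case by (simp only: chain_map_diff chain_weight_diff)
  qed simp
qed


section \<open>Fan's lemma on the sphere\<close>

lemma continuous_map_nsphere_antipode:
  "continuous_map (nsphere m) (nsphere m) (\<lambda>x i. - x i)"
  unfolding nsphere
  by (auto simp: continuous_map_in_subtopology continuous_map_componentwise_UNIV
      intro!: continuous_map_minus continuous_map_from_subtopology continuous_map_product_projection)

text \<open>Reduced homology of the sphere vanishes away from degree \<open>m\<close>. In degree 0
  it is the kernel of the map to a point, and \<open>aug\<close> puts the class of \<open>c\<close>
  there.\<close>

lemma singular_cycle_nsphere_is_boundary:
  assumes c: "singular_relcycle k (nsphere m) {} c" and "k \<noteq> m"
    and aug: "k = 0 \<Longrightarrow> chain_map 0 (\<lambda>x. ()) c = 0"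
  obtains d where "singular_chain (Suc k) (nsphere m) d" "chain_boundary (Suc k) d = c"
proof -
  let ?h = "hom_induced (int k) (nsphere m) {} (discrete_topology {()}) {} (\<lambda>x. ())"
  have triv: "trivial_group (reduced_homology_group (int k) (nsphere m))"
    using assms by (simp add: trivial_reduced_homology_group_nsphere)
  have car: "homologous_rel_set k (nsphere m) {} c \<in> carrier (homology_group (int k) (nsphere m))"
    using c by (auto simp: carrier_relative_homology_group)
  have "homologous_rel_set k (nsphere m) {} c \<in> carrier (reduced_homology_group (int k) (nsphere m))"
  proof (cases "k = 0")
    case True
    have "?h (homologous_rel_set k (nsphere m) {} c)
        = homologous_rel_set k (discrete_topology {()}) {} (chain_map k (\<lambda>x. ()) c)"
      using c by (intro hom_induced_chain_map) auto
    also have "\<dots> = singular_relboundary_set k (discrete_topology {()}) {}"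
      using aug True by (subst homologous_rel_set_eq_relboundary) simp
    also have "\<dots> = \<one>\<^bsub>homology_group (int k) (discrete_topology {()})\<^esub>"
      by simp
    finally show ?thesis
      using car by (simp add: carrier_reduced_homology_group kernel_def)
  next
    case False
    then show ?thesis
      using car by (simp add: un_reduced_homology_group)
  qed
  then have "homologous_rel_set k (nsphere m) {} c = singular_relboundary_set k (nsphere m) {}"
    using triv by (simp add: trivial_group_def one_reduced_homology_group)
  then have "singular_relboundary k (nsphere m) {} c"
    by (simp only: homologous_rel_set_eq_relboundary)
  then show thesis
    using that by (auto simp: singular_boundary)
qed

text \<open>No hemisphere is described explicitly: \<open>e (Suc k)\<close> is any chain filling
  \<open>e k\<close> plus its signed antipode, a cycle in a degree where the sphere is
  acyclic.\<close>

lemma nsphere_hemispheres: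
  fixes m :: nat
  defines "\<nu> \<equiv> \<lambda>x :: nat \<Rightarrow> real. \<lambda>i. - x i"
  obtains e f where
    "e 0 = frag_of f"
    "\<And>k. k \<le> m \<Longrightarrow> singular_chain k (nsphere m) (e k)"
    "\<And>k. k < m \<Longrightarrow> chain_boundary (Suc k) (e (Suc k))
        = e k + frag_cmul ((-1) ^ Suc k) (chain_map k \<nu> (e k))"
proof -
  have cont: "continuous_map (nsphere m) (nsphere m) \<nu>"
    using continuous_map_nsphere_antipode by (simp add: \<nu>_def)
  define f :: "(nat \<Rightarrow> real) \<Rightarrow> nat \<Rightarrow> real"
    where "f = restrict (\<lambda>_ n. if n = 0 then 1 else 0) (standard_simplex 0)"
  have f: "singular_simplex 0 (nsphere m) f"
    using in_topspace_nsphere by (auto simp: f_def singular_simplex_def)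
  have "\<exists>e. e 0 = frag_of f \<and> (\<forall>k\<le>j. singular_chain k (nsphere m) (e k)) \<and>
     (\<forall>k<j. chain_boundary (Suc k) (e (Suc k)) = e k + frag_cmul ((-1) ^ Suc k) (chain_map k \<nu> (e k)))"
    if "j \<le> m" for j
    using that
  proof (induction j)
    case 0
    show ?case
      using f by (intro exI[of _ "\<lambda>_. frag_of f"]) (simp add: singular_chain_of)
  next
    case (Suc j)
    then obtain e where e: "e 0 = frag_of f" "\<And>k. k \<le> j \<Longrightarrow> singular_chain k (nsphere m) (e k)"
      "\<And>k. k < j \<Longrightarrow> chain_boundary (Suc k) (e (Suc k))
          = e k + frag_cmul ((-1) ^ Suc k) (chain_map k \<nu> (e k))"
      by auto
    let ?c = "e j + frag_cmul ((-1) ^ Suc j) (chain_map j \<nu> (e j))"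
    have "chain_boundary j ?c = 0"
    proof (cases j)
      case 0
      then show ?thesis by (simp add: chain_boundary_def)
    next
      case (Suc i)
      have "chain_map i \<nu> (chain_map i \<nu> (e i)) = chain_map i (\<nu> \<circ> \<nu>) (e i)"
        by (simp add: chain_map_compose)
      also have "\<nu> \<circ> \<nu> = id"
        by (auto simp: \<nu>_def)
      also have "chain_map i id (e i) = e i"
        using e(2)[of i] Suc by (intro chain_map_ident) auto
      finally have \<nu>\<nu>: "chain_map i \<nu> (chain_map i \<nu> (e i)) = e i" .
      \<comment> \<open>The boundary of \<open>e j\<close> is \<open>e i - r \<nu>(e i)\<close>,
        that of its antipode is \<open>\<nu>(e i) - r (e i)\<close>; the latter times
        \<open>r\<close> cancels the former, as \<open>r * r = 1\<close>.\<close>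
      define r :: int where "r = (-1) ^ i"
      have r: "r * r = 1" "(-1) ^ Suc i = - r" "(-1) ^ Suc j = r"
        using Suc by (simp_all add: r_def flip: power_add)
      have bd: "chain_boundary j (e j) = e i - frag_cmul r (chain_map i \<nu> (e i))"
        using e(3)[of i] Suc r(2) by simp
      have "chain_boundary j (chain_map j \<nu> (e j)) = chain_map i \<nu> (chain_boundary j (e j))"
        using chain_boundary_chain_map[OF e(2)[of j]] Suc by simp
      also have "\<dots> = chain_map i \<nu> (e i) - frag_cmul r (e i)"
        by (simp only: bd chain_map_diff chain_map_cmul \<nu>\<nu>)
      finally show ?thesis
        unfolding chain_boundary_add chain_boundary_cmul bd r(3)
        by (intro poly_mapping_eqI)
          (simp add: lookup_add lookup_minus right_diff_distrib r(1) flip: mult.assoc)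
    qed
    moreover have "singular_chain j (nsphere m) ?c"
      using e(2)[of j] cont by (intro singular_chain_add singular_chain_cmul singular_chain_chain_map) auto
    ultimately have "singular_relcycle j (nsphere m) {} ?c"
      by (simp add: singular_cycle)
    \<comment> \<open>In degree 0 the chain is a point minus its antipode, and both have the same
      image in the one-point space.\<close>
    moreover have "chain_map 0 (\<lambda>x. ()) ?c = 0" if "j = 0"
    proof -
      have "simplex_map 0 (\<lambda>x. ()) (simplex_map 0 \<nu> f) = simplex_map 0 (\<lambda>x. ()) f"
        by (auto simp: simplex_map_def)
      then show ?thesis
        using that e(1) by (simp add: chain_map_diff)
    qed
    ultimately obtain d where "singular_chain (Suc j) (nsphere m) d" "chain_boundary (Suc j) d = ?c"
      using singular_cycle_nsphere_is_boundary[of j m ?c] Suc.prems by (metis Suc_n_not_le_n)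
    then show ?case
      using e by (intro exI[of _ "e(Suc j := d)"]) (auto simp: less_Suc_eq le_Suc_eq)
  qed
  from this[of m] show thesis
    using that by blast
qed

text \<open>Subdivision is natural and commutes with the boundary, so the hemisphere relation
  survives any number of rounds.\<close>

lemma singular_subdivision_power_antipodal:
  assumes a: "singular_chain (Suc k) X a" and b: "singular_chain k X b"
    and \<nu>: "continuous_map X X \<nu>"
    and ab: "chain_boundary (Suc k) a = b + frag_cmul r (chain_map k \<nu> b)"
  shows "singular_chain (Suc k) X ((singular_subdivision (Suc k) ^^ N) a)" (is "?P N")
    and "chain_boundary (Suc k) ((singular_subdivision (Suc k) ^^ N) a)
      = (singular_subdivision k ^^ N) b + frag_cmul r (chain_map k \<nu> ((singular_subdivision k ^^ N) b))"
      (is "?Q N")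
proof -
  have cmul: "singular_subdivision k (frag_cmul r c) = frag_cmul r (singular_subdivision k c)" for c :: "'a chain"
    by (simp add: singular_subdivision_def frag_extend_cmul)
  have sb: "singular_chain k X ((singular_subdivision k ^^ N) b)" for N
    by (induction N) (auto simp: b singular_chain_singular_subdivision)
  have sa: "?P N" for N
    by (induction N) (auto simp: a singular_chain_singular_subdivision)
  then show "?P N" .
  show "?Q N"
  proof (induction N)
    case 0
    then show ?case using ab by simp
  next
    case (Suc N)
    then show ?case
      using chain_boundary_singular_subdivision[OF sa[of N]] naturality_singular_subdivision[OF sb[of N], of \<nu>]
      by (simp add: singular_subdivision_add cmul)
  qed
qed

text \<open>The cover expresses closeness: after enough subdivisions every singular simplex lies in
  one member, where no two labels cancel, so the parity count applies.\<close>

theorem fan_nsphere: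
  fixes l :: "(nat \<Rightarrow> real) \<Rightarrow> int"
  assumes odd: "\<And>x. x \<in> topspace (nsphere m) \<Longrightarrow> l (\<lambda>i. - x i) = - l x"
    and op: "\<And>U. U \<in> \<C> \<Longrightarrow> openin (nsphere m) U"
    and cover: "topspace (nsphere m) \<subseteq> \<Union>\<C>"
    and nonopp: "\<And>U x y. \<lbrakk>U \<in> \<C>; x \<in> U; y \<in> U\<rbrakk> \<Longrightarrow> l x + l y \<noteq> 0"
  obtains U s x where "U \<in> \<C>" "s = 1 \<or> s = -1" "\<And>i. i \<le> m \<Longrightarrow> x i \<in> U"
    "inj_on (\<lambda>i. l (x i)) {..m}" "alternating s ((\<lambda>i. l (x i)) ` {..m})"
proof -
  define \<nu> where "\<nu> = (\<lambda>x :: nat \<Rightarrow> real. \<lambda>i. - x i)"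
  have cont: "continuous_map (nsphere m) (nsphere m) \<nu>"
    using continuous_map_nsphere_antipode by (simp add: \<nu>_def)
  obtain e f where e: "e 0 = frag_of f"
    "\<And>k. k \<le> m \<Longrightarrow> singular_chain k (nsphere m) (e k)"
    "\<And>k. k < m \<Longrightarrow> chain_boundary (Suc k) (e (Suc k))
        = e k + frag_cmul ((-1) ^ Suc k) (chain_map k \<nu> (e k))"
    using nsphere_hemispheres[of m] unfolding \<nu>_def by metis
  have "\<exists>n. \<forall>N\<ge>n. \<forall>g \<in> Poly_Mapping.keys ((singular_subdivision k ^^ N) (e k)).
      \<exists>V\<in>\<C>. g \<in> standard_simplex k \<rightarrow> V" if "k \<le> m" for k
    using sufficient_iterated_singular_subdivision_exists[of \<C>, OF op cover e(2)[OF that]] by metis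
  then obtain n where n: "\<And>k N g. \<lbrakk>k \<le> m; n k \<le> N; g \<in> Poly_Mapping.keys ((singular_subdivision k ^^ N) (e k))\<rbrakk>
      \<Longrightarrow> \<exists>V\<in>\<C>. g \<in> standard_simplex k \<rightarrow> V"
    by metis
  \<comment> \<open>The number of subdivisions needed depends on the dimension. A common one keeps
    the chains related by the boundary formula.\<close>
  define N where "N = Max (n ` {..m})"
  define c where "c k = (singular_subdivision k ^^ N) (e k)" for k
  have chain: "singular_chain k (nsphere m) (c k)" if "k \<le> m" for k
    unfolding c_def by (induction N) (auto simp: e that singular_chain_singular_subdivision)
  have small: "\<exists>V\<in>\<C>. g \<in> standard_simplex k \<rightarrow> V" if "k \<le> m" "g \<in> Poly_Mapping.keys (c k)" for k g
    using n[of k N g] that by (simp add: c_def N_def)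
  have nonopp': "l (simplex_vertex g i) + l (simplex_vertex g j) \<noteq> 0"
    if g: "k \<le> m" "g \<in> Poly_Mapping.keys (c k)" and "i \<le> k" "j \<le> k" for k g i j
  proof -
    obtain V where "V \<in> \<C>" "g \<in> standard_simplex k \<rightarrow> V"
      using small[OF g] by blast
    then show ?thesis
      using nonopp \<open>i \<le> k\<close> \<open>j \<le> k\<close> by (auto simp: simplex_vertex_def Pi_iff)
  qed
  have "odd (fan_count l 1 k (c k) + fan_count l (-1) k (c k))" if "k \<le> m" for k
    using that
  proof (induction k)
    case 0
    \<comment> \<open>Subdivision fixes 0-chains, so \<open>c 0\<close> is a single point,
      alternating for exactly one sign.\<close>
    have "(singular_subdivision 0 ^^ N) (frag_of f) = frag_of f"
      using e(1) e(2)[of 0] singular_subdivision_zero[of "nsphere m" "frag_of f"] by (induction N) auto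
    then have c0: "c 0 = frag_of f"
      by (simp add: c_def e)
    define t where "t = l (simplex_vertex f 0)"
    have "t \<noteq> 0"
      using nonopp'[of 0 f 0 0] c0 by (auto simp: t_def)
    moreover have "alternating_simplex l s 0 f \<longleftrightarrow> 0 < s * t" for s
      using alternating_insert_iff[of "{}" t s]
      by (simp add: alternating_simplex_def t_def alternating.empty)
    ultimately show ?case
      by (auto simp: c0)
  next
    case (Suc k)
    have "chain_boundary (Suc k) (c (Suc k)) = c k + frag_cmul ((-1) ^ Suc k) (chain_map k \<nu> (c k))"
      unfolding c_def using Suc.prems e(2)[of "Suc k"] e(2)[of k] e(3)[of k] cont
      by (intro singular_subdivision_power_antipodal) auto
    then have "fan_count l 1 k (chain_boundary (Suc k) (c (Suc k)))
        = fan_count l 1 k (c k) + (-1) ^ Suc k * fan_count l 1 k (chain_map k \<nu> (c k))"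
      by (simp only: chain_weight_add chain_weight_cmul)
    \<comment> \<open>The antipode exchanges the two signs, so modulo 2 the boundary counts both
      kinds in \<open>c k\<close>, an odd number by induction.\<close>
    also have "fan_count l 1 k (chain_map k \<nu> (c k)) = fan_count l (-1) k (c k)"
      using fan_count_antipode[OF chain[of k], of l \<nu> 1] Suc.prems odd by (auto simp: \<nu>_def)
    finally have "odd (fan_count l 1 k (chain_boundary (Suc k) (c (Suc k))))"
      using Suc by simp
    moreover have "even (fan_count l 1 k (chain_boundary (Suc k) (c (Suc k)))
        + fan_count l 1 (Suc k) (c (Suc k)) + fan_count l (-1) (Suc k) (c (Suc k)))"
      using nonopp' Suc.prems by (intro fan_count_boundary_parity) auto
    ultimately show ?case
      by presburger
  qed
  then have "odd (fan_count l 1 m (c m) + fan_count l (-1) m (c m))"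
    by simp
  then obtain s where s: "s = 1 \<or> s = -1" "fan_count l s m (c m) \<noteq> 0"
    by (metis add_0 even_zero)
  obtain g where g: "g \<in> Poly_Mapping.keys (c m)" "alternating_simplex l s m g"
    using chain_weight_nonzeroD[OF s(2)] by (metis of_bool_eq_0_iff)
  obtain V where V: "V \<in> \<C>" "g \<in> standard_simplex m \<rightarrow> V"
    using small[of m g] g by blast
  show thesis
  proof (rule that[of V s "simplex_vertex g"])
    show "simplex_vertex g i \<in> V" if "i \<le> m" for i
      using V that by (auto simp: simplex_vertex_def Pi_iff)
  qed (use V s g in \<open>auto simp: alternating_simplex_def\<close>)
qed


section \<open>Fan's lemma for triangulations\<close>

text \<open>For \<open>0 < \<epsilon> < 1\<close>, the points whose barycentric coordinate at
  \<open>v\<close> is at least \<open>\<epsilon>\<close>. Shrinking each simplex at \<open>v\<close>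
  towards \<open>v\<close> presents them as a union of compact images.\<close>

definition vertex_cell :: "('a::euclidean_space) set set \<Rightarrow> real \<Rightarrow> 'a \<Rightarrow> 'a set" where
  "vertex_cell K \<epsilon> v = (\<Union>\<sigma>\<in>{\<sigma>\<in>K. v \<in> \<sigma>}. (\<lambda>x. \<epsilon> *\<^sub>R v + (1 - \<epsilon>) *\<^sub>R x) ` (convex hull \<sigma>))"

lemma closed_vertex_cell:
  assumes "geom_simplicial_complex K"
  shows "closed (vertex_cell K \<epsilon> v)"
proof -
  have "compact ((\<lambda>x. \<epsilon> *\<^sub>R v + (1 - \<epsilon>) *\<^sub>R x) ` (convex hull \<sigma>))" if "\<sigma> \<in> K" for \<sigma>
    using assms that
    by (intro compact_continuous_image continuous_intros finite_imp_compact_convex_hull)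
      (auto simp: geom_simplicial_complex_def)
  then show ?thesis
    using assms unfolding vertex_cell_def geom_simplicial_complex_def
    by (intro closed_UN) (auto intro: compact_imp_closed)
qed

text \<open>Barycentric coordinates sum to 1, so one of them is at least
  \<open>1 / card \<sigma>\<close>, hence at least \<open>\<epsilon>\<close>.\<close>

lemma vertex_cell_cover:
  fixes \<epsilon> :: real
  assumes K: "geom_simplicial_complex K" and \<epsilon>: "0 < \<epsilon>" "\<epsilon> < 1"
    and card: "\<And>\<sigma>. \<sigma> \<in> K \<Longrightarrow> \<epsilon> * card \<sigma> \<le> 1"
    and x: "x \<in> Defs.polyhedron K"
  obtains v where "v \<in> vertices K" "x \<in> vertex_cell K \<epsilon> v"
proof -
  obtain \<sigma> where \<sigma>: "\<sigma> \<in> K" "x \<in> convex hull \<sigma>"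
    using x by (auto simp: Defs.polyhedron_def)
  have fin: "finite \<sigma>" "\<sigma> \<noteq> {}"
    using K \<sigma> by (auto simp: geom_simplicial_complex_def)
  then obtain u where u: "\<And>w. w \<in> \<sigma> \<Longrightarrow> 0 \<le> u w" "sum u \<sigma> = 1" "(\<Sum>w\<in>\<sigma>. u w *\<^sub>R w) = x"
    using \<sigma>(2) unfolding convex_hull_finite[OF fin(1)] by blast
  have "\<exists>v\<in>\<sigma>. \<epsilon> \<le> u v"
  proof (rule ccontr)
    assume "\<not> ?thesis"
    then have "sum u \<sigma> < (\<Sum>w\<in>\<sigma>. \<epsilon>)"
      by (intro sum_strict_mono fin) (simp add: not_le)
    then show False
      using u(2) card[OF \<sigma>(1)] by (simp add: mult.commute)
  qed
  then obtain v where v: "v \<in> \<sigma>" "\<epsilon> \<le> u v" by blast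
  \<comment> \<open>Coordinates of the point that the shrinking towards \<open>v\<close> sends to
    \<open>x\<close>: the one at \<open>v\<close> drops by \<open>\<epsilon>\<close>, and all are
    rescaled to sum to 1.\<close>
  define u' where "u' w = (u w - (if w = v then \<epsilon> else 0)) / (1 - \<epsilon>)" for w
  define y where "y = (\<Sum>w\<in>\<sigma>. u' w *\<^sub>R w)"
  have "sum u' \<sigma> = (sum u \<sigma> - (\<Sum>w\<in>\<sigma>. if w = v then \<epsilon> else 0)) / (1 - \<epsilon>)"
    unfolding u'_def by (simp only: sum_divide_distrib[symmetric] sum_subtractf)
  then have "sum u' \<sigma> = 1"
    using fin v \<epsilon> u(2) by simp
  moreover have "\<And>w. w \<in> \<sigma> \<Longrightarrow> 0 \<le> u' w"
    using u(1) v \<epsilon> by (auto simp: u'_def)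
  ultimately have y: "y \<in> convex hull \<sigma>"
    unfolding convex_hull_finite[OF fin(1)] y_def by blast
  have "(1 - \<epsilon>) *\<^sub>R y = (\<Sum>w\<in>\<sigma>. (u w - (if w = v then \<epsilon> else 0)) *\<^sub>R w)"
    using \<epsilon> by (simp add: y_def u'_def scaleR_sum_right)
  also have "\<dots> = x - (\<Sum>w\<in>\<sigma>. (if w = v then \<epsilon> else 0) *\<^sub>R w)"
    by (simp add: scaleR_left_diff_distrib sum_subtractf u(3))
  also have "(\<Sum>w\<in>\<sigma>. (if w = v then \<epsilon> else 0) *\<^sub>R w) = (\<Sum>w\<in>\<sigma>. if w = v then \<epsilon> *\<^sub>R v else 0)"
    by (intro sum.cong) auto
  also have "\<dots> = \<epsilon> *\<^sub>R v"
    using fin v by simp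
  finally have "x = \<epsilon> *\<^sub>R v + (1 - \<epsilon>) *\<^sub>R y"
    by simp
  then show thesis
    using that[of v] v \<sigma>(1) y by (auto simp: vertex_cell_def vertices_def)
qed

text \<open>The point \<open>x\<close> is \<open>v\<close> itself or lies inside a segment from
  \<open>v\<close> to a point of the hull of \<open>\<sigma>\<close>. It also lies in the face
  spanned by \<open>\<sigma> \<inter> \<tau>\<close>, and a face containing an inner point of a
  segment contains its ends.\<close>

lemma vertex_cell_carrier:
  assumes K: "geom_simplicial_complex K" and \<epsilon>: "0 < \<epsilon>" "\<epsilon> < 1"
    and x: "x \<in> vertex_cell K \<epsilon> v" and \<tau>: "\<tau> \<in> K" "x \<in> convex hull \<tau>"
  shows "v \<in> \<tau>"
proof -
  obtain \<sigma> y where \<sigma>: "\<sigma> \<in> K" "v \<in> \<sigma>" and y: "y \<in> convex hull \<sigma>" "x = (1 - \<epsilon>) *\<^sub>R y + \<epsilon> *\<^sub>R v"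
    using x by (auto simp: vertex_cell_def add.commute)
  have indep: "\<not> affine_dependent \<sigma>"
    using K \<sigma> by (auto simp: geom_simplicial_complex_def)
  have v: "v \<in> convex hull \<sigma>"
    using \<sigma> by (simp add: hull_inc)
  have "x \<in> convex hull \<sigma>"
    using y v \<epsilon> by (auto intro: convexD_alt)
  then have xc: "x \<in> convex hull (\<sigma> \<inter> \<tau>)"
    using K \<sigma>(1) \<tau> unfolding geom_simplicial_complex_def by blast
  have face: "convex hull (\<sigma> \<inter> \<tau>) face_of convex hull \<sigma>"
    using face_of_convex_hull_affine_independent[OF indep] by blast
  have "v \<in> convex hull (\<sigma> \<inter> \<tau>)"
  proof (cases "y = v")
    case True
    then have "x = v"
      using y(2) by (simp flip: scaleR_left_distrib)
    then show ?thesis using xc by simp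
  next
    case False
    then have "x \<in> open_segment y v"
      using y(2) \<epsilon> by (auto simp: in_segment)
    then show ?thesis
      using face_ofD[OF face _ y(1) v xc] by blast
  qed
  then have "v \<in> affine hull (\<sigma> \<inter> \<tau>)"
    using convex_hull_subset_affine_hull by blast
  \<comment> \<open>Otherwise \<open>\<sigma> \<inter> \<tau>\<close> would lie in
    \<open>\<sigma> - {v}\<close>, making \<open>v\<close> affinely dependent on the other
    vertices.\<close>
  then have "v \<in> \<sigma> \<inter> \<tau>"
    using indep \<sigma>(2) hull_mono[of "\<sigma> \<inter> \<tau>" "\<sigma> - {v}" affine] by (auto simp: affine_dependent_def)
  then show ?thesis by simp
qed

lemma convex_hull_uminus: "convex hull (uminus ` S) = uminus ` (convex hull (S :: 'a::real_vector set))"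
  using convex_hull_scaling[of "-1" S] by simp

lemma uminus_vertex_cell:
  assumes K: "\<And>\<sigma>. \<sigma> \<in> K \<Longrightarrow> uminus ` \<sigma> \<in> K" and x: "x \<in> vertex_cell K \<epsilon> v"
  shows "- x \<in> vertex_cell K \<epsilon> (- v)"
proof -
  obtain \<sigma> y where \<sigma>: "\<sigma> \<in> K" "v \<in> \<sigma>" and y: "y \<in> convex hull \<sigma>" "x = \<epsilon> *\<^sub>R v + (1 - \<epsilon>) *\<^sub>R y"
    using x by (auto simp: vertex_cell_def)
  have "- y \<in> convex hull (uminus ` \<sigma>)"
    using y(1) by (simp add: convex_hull_uminus)
  moreover have "- x = \<epsilon> *\<^sub>R (- v) + (1 - \<epsilon>) *\<^sub>R (- y)"
    by (simp add: y(2))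
  ultimately show ?thesis
    using K[OF \<sigma>(1)] \<sigma>(2) unfolding vertex_cell_def by blast
qed

text \<open>The choice is kept at one point of each antipodal pair and reflected to the other;
  \<open>0 \<notin> P\<close> makes the two points different.\<close>

lemma odd_choice:
  fixes w :: "'a::real_vector \<Rightarrow> 'b::real_vector"
  assumes P: "\<And>x. x \<in> P \<Longrightarrow> - x \<in> P" "0 \<notin> P"
    and w: "\<And>x. x \<in> P \<Longrightarrow> R x (w x)" and R: "\<And>x v. R x v \<Longrightarrow> R (- x) (- v)"
  obtains v where "\<And>x. x \<in> P \<Longrightarrow> R x (v x)" "\<And>x. x \<in> P \<Longrightarrow> v (- x) = - v x"
proof -
  \<comment> \<open>\<open>SOME\<close> sees only the set, which is the same for \<open>x\<close>
    and \<open>- x\<close>, so both get the same representative.\<close>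
  define rep where "rep x = (SOME y. y \<in> {x, - x})" for x :: 'a
  have rep: "rep (- x) = rep x" "rep x \<in> {x, - x}" for x
    unfolding rep_def by (simp add: insert_commute) (rule someI[of _ x], simp)
  have ne: "x \<noteq> - x" if "x \<in> P" for x
  proof
    assume "x = - x"
    then have "2 *\<^sub>R x = 0"
      by (simp only: scaleR_2 eq_neg_iff_add_eq_0)
    then show False
      using P(2) that by simp
  qed
  define v where "v x = (if rep x = x then w x else - w (- x))" for x
  show thesis
  proof (rule that[of v])
    fix x assume x: "x \<in> P"
    then show "R x (v x)"
      using w[of x] R[OF w[of "- x"]] P by (auto simp: v_def)
    show "v (- x) = - v x"
      using rep[of x] ne[OF x] by (auto simp: v_def)
  qed
qed

text \<open>Homology is computed on a sphere of sequences supported on the indices 0 to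
  \<open>m\<close>, hence \<open>m = CARD('n) - 1\<close>; enumerating the coordinates leads to
  \<open>real^'n\<close>.\<close>

lemma continuous_odd_map_nsphere_to_sphere:
  obtains \<phi> :: "(nat \<Rightarrow> real) \<Rightarrow> real^'n"
  where "continuous_map (nsphere (CARD('n) - 1)) (top_of_set (sphere 0 1)) \<phi>"
    "\<And>x. \<phi> (\<lambda>i. - x i) = - \<phi> x"
proof -
  obtain idx :: "'n \<Rightarrow> nat" where idx: "bij_betw idx UNIV {..<CARD('n)}"
    using ex_bij_betw_finite_nat[of "UNIV :: 'n set"] by (auto simp: atLeast0LessThan)
  define \<phi> :: "(nat \<Rightarrow> real) \<Rightarrow> real^'n" where "\<phi> x = (\<chi> i. x (idx i))" for x
  have m: "{..CARD('n) - 1} = {..<CARD('n)}"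
    by (metis One_nat_def Suc_pred lessThan_Suc_atMost zero_less_card_finite)
  have "norm (\<phi> x) = 1" if "x \<in> topspace (nsphere (CARD('n) - 1))" for x
  proof -
    have "(norm (\<phi> x))\<^sup>2 = (\<Sum>i\<in>UNIV. (x (idx i))\<^sup>2)"
      by (simp add: norm_vec_def L2_set_def sum_nonneg \<phi>_def)
    also have "\<dots> = (\<Sum>j<CARD('n). (x j)\<^sup>2)"
      using idx by (rule sum.reindex_bij_betw)
    also have "\<dots> = 1"
      using that unfolding m[symmetric] by (simp add: nsphere)
    finally show ?thesis
      by (metis norm_ge_zero one_power2 power2_eq_imp_eq zero_le_one)
  qed
  moreover have "continuous_map (nsphere (CARD('n) - 1)) euclidean \<phi>"
  proof -
    have "continuous_on UNIV \<phi>"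
      unfolding \<phi>_def by (intro continuous_on_vec_lambda continuous_on_product_coordinates)
    then have "continuous_map (powertop_real UNIV) euclidean \<phi>"
      unfolding euclidean_product_topology by simp
    then show ?thesis
      unfolding nsphere by (rule continuous_map_from_subtopology)
  qed
  ultimately have "continuous_map (nsphere (CARD('n) - 1)) (top_of_set (sphere 0 1)) \<phi>"
    by (auto simp: continuous_map_in_subtopology)
  then show thesis
    by (rule that) (simp add: \<phi>_def vec_eq_iff)
qed

text \<open>Labels are pulled back to the sphere through the inverse homeomorphism. The leading sign
  becomes -1 by passing, if necessary, to the antipodal simplex.\<close>

lemma fan_triangulation_vertices:
  fixes K :: "('a::euclidean_space) set set"
  assumes T: "cs_sphere_triangulation K (sphere (0::real^'n) 1)" and l: "fan_labeling K l"
  obtains \<tau> L and v :: "int \<Rightarrow> 'a" where "\<tau> \<in> K" "alternating (-1) L" "card L = CARD('n)"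
    "\<And>z. z \<in> L \<Longrightarrow> v z \<in> \<tau> \<and> l (v z) = z"
proof -
  define m where "m = CARD('n) - 1"
  have K: "geom_simplicial_complex K" and symK: "\<And>\<sigma>. \<sigma> \<in> K \<Longrightarrow> uminus ` \<sigma> \<in> K"
    using T by (auto simp: cs_sphere_triangulation_def)
  define P where "P = Defs.polyhedron K"
  obtain h g where hom: "homeomorphism P (sphere (0::real^'n) 1) h g"
    and h: "\<And>x. x \<in> P \<Longrightarrow> h (- x) = - h x"
    using T by (auto simp: cs_sphere_triangulation_def P_def)
  have symP: "- x \<in> P" if x: "x \<in> P" for x
  proof -
    obtain \<sigma> where "\<sigma> \<in> K" "x \<in> convex hull \<sigma>"
      using x by (auto simp: P_def Defs.polyhedron_def)
    then have "- x \<in> convex hull (uminus ` \<sigma>)" "uminus ` \<sigma> \<in> K"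
      using symK by (auto simp: convex_hull_uminus)
    then show ?thesis
      unfolding P_def Defs.polyhedron_def by blast
  qed
  have "0 \<notin> P"
  proof
    assume "0 \<in> P"
    then have "h 0 \<in> sphere 0 1" "h 0 = - h 0"
      using h[of 0] homeomorphism_image1[OF hom] by auto
    then show False
      by (metis dist_0_norm eq_neg_iff_add_eq_0 mem_sphere norm_zero scaleR_2 scaleR_eq_0_iff
          zero_neq_numeral zero_neq_one)
  qed
  have g: "g x \<in> P" "g (- x) = - g x" if "x \<in> sphere 0 1" for x
  proof -
    show gx: "g x \<in> P"
      using homeomorphism_image2[OF hom] that by blast
    have "h (- g x) = - x"
      using h[OF gx] homeomorphism_apply2[OF hom that] by simp
    then show "g (- x) = - g x"
      using homeomorphism_apply1[OF hom symP[OF gx]] by simp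
  qed
  obtain \<phi> :: "(nat \<Rightarrow> real) \<Rightarrow> real^'n" where
    \<phi>: "continuous_map (nsphere m) (top_of_set (sphere 0 1)) \<phi>" "\<And>x. \<phi> (\<lambda>i. - x i) = - \<phi> x"
    using continuous_odd_map_nsphere_to_sphere[where 'n = 'n] unfolding m_def by metis
  define \<gamma> where "\<gamma> = g \<circ> \<phi>"
  have \<phi>_sphere: "\<phi> x \<in> sphere 0 1" if "x \<in> topspace (nsphere m)" for x
    using \<phi>(1) that by (auto simp: continuous_map_in_subtopology)
  have \<gamma>: "\<gamma> x \<in> P" "\<gamma> (\<lambda>i. - x i) = - \<gamma> x" if "x \<in> topspace (nsphere m)" for x
    using g[OF \<phi>_sphere[OF that]] by (auto simp: \<gamma>_def \<phi>(2))
  have \<gamma>_cont: "continuous_map (nsphere m) euclidean \<gamma>"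
    using \<phi>(1) homeomorphism_cont2[OF hom]
    unfolding \<gamma>_def by (intro continuous_map_compose[OF \<phi>(1)]) simp

  have finV: "finite (vertices K)"
    using K by (auto simp: vertices_def geom_simplicial_complex_def)
  \<comment> \<open>No simplex has more than \<open>card (vertices K)\<close> vertices, so the cells
    cover; the summand 2 keeps \<open>\<epsilon>\<close> below 1 in every case.\<close>
  define \<epsilon> where "\<epsilon> = 1 / real (card (vertices K) + 2)"
  have \<epsilon>: "0 < \<epsilon>" "\<epsilon> < 1"
    by (auto simp: \<epsilon>_def)
  have card: "\<epsilon> * card \<sigma> \<le> 1" if "\<sigma> \<in> K" for \<sigma>
  proof -
    have "card \<sigma> \<le> card (vertices K)"
      using finV that by (intro card_mono) (auto simp: vertices_def)
    then show ?thesis by (simp add: \<epsilon>_def)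
  qed
  define cell where "cell = vertex_cell K \<epsilon>"
  have "\<exists>u. x \<in> cell u" if "x \<in> P" for x
  proof (rule vertex_cell_cover[OF K \<epsilon>])
    show "x \<in> Defs.polyhedron K"
      using that by (simp add: P_def)
  qed (use card in \<open>auto simp: cell_def\<close>)
  then obtain w where "\<And>x. x \<in> P \<Longrightarrow> x \<in> cell (w x)"
    by metis
  moreover have "\<And>x v. x \<in> cell v \<Longrightarrow> - x \<in> cell (- v)"
    unfolding cell_def by (rule uminus_vertex_cell[OF symK])
  ultimately obtain v where v: "\<And>x. x \<in> P \<Longrightarrow> x \<in> cell (v x)" "\<And>x. x \<in> P \<Longrightarrow> v (- x) = - v x"
    using odd_choice[OF symP \<open>0 \<notin> P\<close>, where R = "\<lambda>x v. x \<in> cell v"] by metis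
  have vV: "v x \<in> vertices K" if "x \<in> P" for x
    using v(1)[OF that] by (auto simp: cell_def vertex_cell_def vertices_def)
  have l0: "l u \<noteq> 0" "l (- u) = - l u" if "u \<in> vertices K" for u
    using l that by (auto simp: fan_labeling_def)

  \<comment> \<open>Removing the finitely many closed cells that miss \<open>y\<close> leaves an
    open neighbourhood of \<open>y\<close> that meets only cells containing
    \<open>y\<close>.\<close>
  define W where "W y = - (\<Union>u\<in>{u \<in> vertices K. y \<notin> cell u}. cell u)" for y
  define \<C> where "\<C> = (\<lambda>y. {x \<in> topspace (nsphere m). \<gamma> x \<in> W y}) ` P"
  \<comment> \<open>The vertices chosen over \<open>U\<close> have cells containing
    \<open>y\<close>, so all lie in any simplex whose hull contains \<open>y\<close>.\<close>
  have carrier: "\<exists>\<tau>\<in>K. \<forall>x\<in>U. v (\<gamma> x) \<in> \<tau>" if U: "U \<in> \<C>" for U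
  proof -
    obtain y where y: "y \<in> P" "U = {x \<in> topspace (nsphere m). \<gamma> x \<in> W y}"
      using U by (auto simp: \<C>_def)
    obtain \<tau> where \<tau>: "\<tau> \<in> K" "y \<in> convex hull \<tau>"
      using y(1) by (auto simp: P_def Defs.polyhedron_def)
    have "v (\<gamma> x) \<in> \<tau>" if "x \<in> U" for x
    proof -
      have "\<gamma> x \<in> P" "\<gamma> x \<in> W y"
        using that \<gamma> y(2) by auto
      then have "y \<in> cell (v (\<gamma> x))"
        using v(1) vV by (auto simp: W_def)
      then show ?thesis
        using vertex_cell_carrier[OF K \<epsilon> _ \<tau>] by (simp add: cell_def)
    qed
    then show ?thesis
      using \<tau> by blast
  qed
  have UP: "x \<in> topspace (nsphere m)" if "U \<in> \<C>" "x \<in> U" for U x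
    using that by (auto simp: \<C>_def)
  obtain U s x where U: "U \<in> \<C>" and s: "s = 1 \<or> s = -1" and x: "\<And>i. i \<le> m \<Longrightarrow> x i \<in> U"
    and inj: "inj_on (\<lambda>i. l (v (\<gamma> (x i)))) {..m}"
    and alt: "alternating s ((\<lambda>i. l (v (\<gamma> (x i)))) ` {..m})"
  proof (rule fan_nsphere[of m "\<lambda>x. l (v (\<gamma> x))" \<C>])
    show "l (v (\<gamma> (\<lambda>i. - x i))) = - l (v (\<gamma> x))" if "x \<in> topspace (nsphere m)" for x
      using \<gamma>[OF that] v(2) vV l0(2) by simp
    show "openin (nsphere m) U" if "U \<in> \<C>" for U
    proof -
      have "open (W y)" for y
        using finV closed_vertex_cell[OF K]
        by (auto simp: W_def cell_def open_Compl intro!: closed_UN)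
      then show ?thesis
        using that \<gamma>_cont unfolding \<C>_def by (auto intro: openin_continuous_map_preimage)
    qed
    show "topspace (nsphere m) \<subseteq> \<Union>\<C>"
      using \<gamma> by (force simp: \<C>_def W_def)
    show "l (v (\<gamma> a)) + l (v (\<gamma> b)) \<noteq> 0" if ab: "U \<in> \<C>" "a \<in> U" "b \<in> U" for U a b
    proof (cases "v (\<gamma> a) = v (\<gamma> b)")
      case True
      then show ?thesis
        using l0(1)[OF vV[OF \<gamma>(1)[OF UP[OF ab(1,3)]]]] by simp
    next
      case False
      obtain \<tau> where "\<tau> \<in> K" "{v (\<gamma> a), v (\<gamma> b)} \<subseteq> \<tau>"
        using carrier[OF ab(1)] ab(2,3) by blast
      then have "{v (\<gamma> a), v (\<gamma> b)} \<in> K"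
        using K unfolding geom_simplicial_complex_def by blast
      then show ?thesis
        using l False by (auto simp: fan_labeling_def adjacent_def)
    qed
  qed blast
  obtain \<tau> where \<tau>: "\<tau> \<in> K" "\<And>i. i \<le> m \<Longrightarrow> v (\<gamma> (x i)) \<in> \<tau>"
    using carrier[OF U] x by blast
  define t where "t i = l (v (\<gamma> (x i)))" for i
  define ix where "ix = inv_into {..m} t"
  have card_t: "card (t ` {..m}) = CARD('n)"
    using inj by (simp add: card_image t_def[abs_def] m_def)
  have ix: "ix z \<le> m" "t (ix z) = z" if "z \<in> t ` {..m}" for z
    using inv_into_into[OF that] f_inv_into_f[OF that] by (auto simp: ix_def)
  have altt: "alternating s (t ` {..m})"
    using alt by (simp add: t_def[abs_def])
  from s show thesis
  proof
    assume "s = -1"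
    show thesis
    proof (rule that[of \<tau> "t ` {..m}" "\<lambda>z. v (\<gamma> (x (ix z)))"])
      show "v (\<gamma> (x (ix z))) \<in> \<tau> \<and> l (v (\<gamma> (x (ix z)))) = z" if "z \<in> t ` {..m}" for z
        using \<tau>(2)[OF ix(1)[OF that]] ix(2)[OF that] unfolding t_def by blast
    qed (use \<tau>(1) altt card_t \<open>s = -1\<close> in auto)
  next
    \<comment> \<open>The antipodal simplex carries the opposite labels, so its pattern starts with
      a negative one.\<close>
    assume "s = 1"
    show thesis
    proof (rule that[of "uminus ` \<tau>" "uminus ` t ` {..m}" "\<lambda>z. - v (\<gamma> (x (ix (- z))))"])
      show "alternating (- 1) (uminus ` t ` {..m})"
        using alternating_uminus[OF altt] \<open>s = 1\<close> by simp
      show "card (uminus ` t ` {..m}) = CARD('n)"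
        using card_t by (simp add: card_image)
      show "- v (\<gamma> (x (ix (- z)))) \<in> uminus ` \<tau> \<and> l (- v (\<gamma> (x (ix (- z))))) = z"
        if z: "z \<in> uminus ` t ` {..m}" for z
      proof -
        have iz: "ix (- z) \<le> m" "t (ix (- z)) = - z"
          using ix[of "- z"] z by auto
        then have "v (\<gamma> (x (ix (- z)))) \<in> \<tau>"
          using \<tau> by blast
        then show ?thesis
          using iz \<tau>(1) l0(2)[of "v (\<gamma> (x (ix (- z))))"] by (auto simp: t_def vertices_def)
      qed
    qed (use symK \<tau> in auto)
  qed
qed

theorem fan_triangulation:
  fixes K :: "('a::euclidean_space) set set"
  assumes T: "cs_sphere_triangulation K (sphere (0::real^'n) 1)" and l: "fan_labeling K l"
  obtains vs where "set vs \<in> K" "distinct vs" "length vs = CARD('n)" "0 < - l (vs ! 0)"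
    "\<And>k. k + 1 < CARD('n) \<Longrightarrow> (-1) ^ (k + 1) * l (vs ! k) < (-1) ^ (k + 2) * l (vs ! (k + 1))"
proof -
  obtain \<tau> L and v :: "int \<Rightarrow> 'a" where \<tau>: "\<tau> \<in> K" and L: "alternating (-1) L" "card L = CARD('n)"
    and v: "\<And>z. z \<in> L \<Longrightarrow> v z \<in> \<tau> \<and> l (v z) = z"
    using fan_triangulation_vertices[OF T l] by blast
  obtain xs where xs: "set xs = L" "distinct xs"
    "\<And>k. k < length xs \<Longrightarrow> 0 < - 1 * (-1) ^ k * xs ! k"
    "\<And>k. Suc k < length xs \<Longrightarrow> \<bar>xs ! k\<bar> < \<bar>xs ! Suc k\<bar>"
    using alternating_list[OF L(1)] by blast
  have len: "length xs = CARD('n)"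
    using xs(1,2) L(2) distinct_card by fastforce
  have lv: "l (map v xs ! k) = xs ! k" if "k < CARD('n)" for k
    using v xs(1) that len by (metis length_map nth_map nth_mem)
  \<comment> \<open>With a negative start, the sign factor turns each label into its absolute value,
    so the required chain is the increase of absolute values.\<close>
  have abs: "(-1) ^ (k + 1) * xs ! k = \<bar>xs ! k\<bar>" if "k < CARD('n)" for k
    using xs(3)[of k] that len by (cases "even k") auto
  show thesis
  proof (rule that[of "map v xs"])
    have "CARD('n) > 0"
      by simp
    then have "set (map v xs) \<noteq> {}"
      using len by auto
    moreover have "set (map v xs) \<subseteq> \<tau>"
      using v xs(1) by auto
    ultimately show "set (map v xs) \<in> K"
      using assms(1) \<tau> unfolding cs_sphere_triangulation_def geom_simplicial_complex_def by blast
    have "inj_on v L"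
      using v by (metis inj_onI)
    then show "distinct (map v xs)"
      using xs by (simp add: distinct_map)
    show "0 < - l (map v xs ! 0)"
      using lv[of 0] xs(3)[of 0] len by simp
    show "(-1) ^ (k + 1) * l (map v xs ! k) < (-1) ^ (k + 2) * l (map v xs ! (k + 1))"
      if "k + 1 < CARD('n)" for k
      using abs[of k] abs[of "k + 1"] lv[of k] lv[of "k + 1"] xs(4)[of k] that len by simp
  qed (use len in simp)
qed

section \<open>Counting pairs by permuting the colours\<close>

theorem theorem4p1:
  fixes K :: "('a::euclidean_space) set set"
    and lab :: "nat \<Rightarrow> 'a \<Rightarrow> int"
  assumes "cs_sphere_triangulation K (sphere (0::real^'n) 1)"
    and "\<forall>i\<in>{1..CARD('n)}. fan_labeling K (lab i)"
    and "compatible_labelings K {1..CARD('n)} lab"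
    and "quotient_balanced K CARD('n)"
  shows "fact CARD('n) \<le> card (good_pairs K CARD('n) lab)"
proof -
  let ?n = "CARD('n)"
  obtain c :: "'a \<Rightarrow> nat" where c: "\<And>v. v \<in> vertices K \<Longrightarrow> c v < ?n \<and> c (- v) = c v"
    "\<And>\<sigma>. \<sigma> \<in> K \<Longrightarrow> card \<sigma> = ?n \<Longrightarrow> inj_on c \<sigma>"
    using assms(4) unfolding quotient_balanced_def by blast
  \<comment> \<open>Colours start at 0, labeling indices at 1.\<close>
  define col where "col v = Suc (c v)" for v
  have col: "col v \<in> {1..?n}" "col (- v) = col v" if "v \<in> vertices K" for v
    using c(1)[OF that] by (auto simp: col_def)
  have bij: "bij_betw col \<sigma> {1..?n}" if "\<sigma> \<in> K" "card \<sigma> = ?n" for \<sigma>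
  proof -
    have inj: "inj_on col \<sigma>"
      using c(2)[OF that] by (auto simp: inj_on_def col_def)
    moreover have "col ` \<sigma> \<subseteq> {1..?n}"
      using col(1) that(1) unfolding vertices_def by blast
    ultimately have "col ` \<sigma> = {1..?n}"
      using that(2) by (intro card_subset_eq) (auto simp: card_image)
    with inj show ?thesis
      by (simp add: bij_betw_def)
  qed
  have finK: "finite K" "\<And>\<sigma>. \<sigma> \<in> K \<Longrightarrow> finite \<sigma>"
    using assms(1) by (auto simp: cs_sphere_triangulation_def geom_simplicial_complex_def)
  let ?Perm = "{p. p permutes {1..?n}}"
  have "\<exists>\<sigma>\<in>K. card \<sigma> = ?n \<and> (\<sigma>, restrict (p \<circ> col) \<sigma>) \<in> good_pairs K ?n lab"
    if p: "p permutes {1..?n}" for p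
  proof -
    have pcol: "p (col v) \<in> {1..?n}" if "v \<in> vertices K" for v
      using col(1)[OF that] permutes_in_image[OF p] by blast
    \<comment> \<open>Antipodal vertices share a colour and hence a labeling, which keeps
      \<open>l\<close> odd; an edge may mix two labelings, and compatibility covers that
      case.\<close>
    define l where "l v = lab (p (col v)) v" for v
    have "fan_labeling K l"
      unfolding fan_labeling_def
    proof (intro conjI ballI allI impI)
      fix v assume "v \<in> vertices K"
      then show "l v \<noteq> 0" "l (- v) + l v = 0"
        using assms(2) pcol col(2) by (auto simp: l_def fan_labeling_def)
    next
      fix u u' assume "adjacent K u u'"
      moreover from this have "u \<in> vertices K" "u' \<in> vertices K"
        by (auto simp: adjacent_def vertices_def)
      ultimately show "l u + l u' \<noteq> 0"
        using assms(3) pcol unfolding compatible_labelings_def l_def by blast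
    qed
    from fan_triangulation[OF assms(1) this] obtain vs where
      vs: "set vs \<in> K" "distinct vs" "length vs = ?n" "0 < - l (vs ! 0)"
      "\<And>k. k + 1 < ?n \<Longrightarrow> (-1) ^ (k + 1) * l (vs ! k) < (-1) ^ (k + 2) * l (vs ! (k + 1))"
      by metis
    have card: "card (set vs) = ?n"
      using vs by (simp add: distinct_card)
    let ?\<pi> = "restrict (p \<circ> col) (set vs)"
    have "bij_betw (p \<circ> col) (set vs) {1..?n}"
      using bij[OF vs(1) card] permutes_imp_bij[OF p] by (rule bij_betw_trans)
    then have b\<pi>: "bij_betw ?\<pi> (set vs) {1..?n}"
      by (simp add: bij_betw_def inj_on_def)
    have lab: "lab (?\<pi> (vs ! k)) (vs ! k) = l (vs ! k)" if "k < ?n" for k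
      using that vs(3) by (simp add: l_def)
    have "alt_chain lab ?\<pi> vs"
      using vs(3-5) lab by (simp add: alt_chain_def Let_def)
    moreover have "?\<pi> \<in> set vs \<rightarrow>\<^sub>E {1..?n}"
      using b\<pi> by (auto simp: bij_betw_def)
    ultimately show ?thesis
      using vs(1,2) card b\<pi> unfolding good_pairs_def by blast
  qed
  then obtain \<sigma> where \<sigma>: "\<And>p. p permutes {1..?n} \<Longrightarrow> \<sigma> p \<in> K \<and> card (\<sigma> p) = ?n \<and>
      (\<sigma> p, restrict (p \<circ> col) (\<sigma> p)) \<in> good_pairs K ?n lab"
    by metis
  let ?F = "\<lambda>p. (\<sigma> p, restrict (p \<circ> col) (\<sigma> p))"
  \<comment> \<open>Equal pairs share their simplex, on which \<open>col\<close> attains all of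
    \<open>{1..?n}\<close>, so the second components determine the permutation.\<close>
  have "inj_on ?F ?Perm"
  proof (rule inj_onI)
    fix p q assume p: "p \<in> ?Perm" and q: "q \<in> ?Perm" and eq: "?F p = ?F q"
    have pq: "p (col v) = q (col v)" if "v \<in> \<sigma> p" for v
      using eq that by (metis (no_types, lifting) Pair_inject comp_apply restrict_apply')
    have "p i = q i" if "i \<in> {1..?n}" for i
    proof -
      have "i \<in> col ` \<sigma> p"
        using bij[of "\<sigma> p"] \<sigma>[of p] p that by (auto simp: bij_betw_def)
      then show ?thesis
        using pq by blast
    qed
    moreover have "p i = q i" if "i \<notin> {1..?n}" for i
      using p q that by (simp add: permutes_not_in)
    ultimately show "p = q"
      by blast
  qed
  moreover have "?F ` ?Perm \<subseteq> good_pairs K ?n lab"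
    using \<sigma> by blast
  \<comment> \<open>An infinite set has \<open>card\<close> 0, so the lower bound requires
    finiteness.\<close>
  moreover have "finite (good_pairs K ?n lab)"
  proof (rule finite_subset)
    show "good_pairs K ?n lab \<subseteq> (SIGMA \<sigma>:K. \<sigma> \<rightarrow>\<^sub>E {1..?n})"
      by (auto simp: good_pairs_def)
    show "finite (SIGMA \<sigma>:K. \<sigma> \<rightarrow>\<^sub>E {1..?n})"
      using finK by (intro finite_SigmaI finite_PiE) auto
  qed
  ultimately have "card ?Perm \<le> card (good_pairs K ?n lab)"
    by (rule card_inj_on_le)
  then show ?thesis
    by (simp add: card_permutations)
qed

end
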